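(* Let $\mathcal{R}:\mathbb{R}^{I_T}\to\mathbb{R}^{I_T}$ be the space-time residual $$\mathcal{R}(u)_j^n:=\begin{cases}\dfrac{u_j^n-u_j^{n-1}}{\Delta t}+\mathcal{H}(x_j,u_j^n,\nabla_G u_j^n),&(j,n)\in\mathcal{J}\times\{1,\dots,N\},\\[4pt] \lambda_b(u_j^n-g_j^n),&(j,n)\in\mathcal{B}\times\{1,\dots,N\},\\ \lambda_0(u_j^0-g_j^0),&(j,n)\in\mathcal{J}\times\{0\},\end{cases}$$ with constants $\lambda_b,\lambda_0>0$, and assume that $\mathcal{H}$ satisfies (H1) and (H2). Then: (i) there exists a unique $\bar u\in\mathbb{R}^{I_T}$ such that $\mathcal{R}(\bar u)=0$; (ii) this solution is the unique critical point of the functional $L(u):=\|\mathcal{R}(u)\|_2^2$, i.e. the unique $u\in\mathbb{R}^{I_T}$ with $0\in\partial L(u)$.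
   Context: Setting. $V$ is a finite index set, $\{x_j\}_{j\in V}$ are nodes which are the vertices of a directed graph; $\mathcal{V}_j\subset V$ is the set of (out-)neighbors of $j$, with $j\notin\mathcal{V}_j$. Put $\mathcal{J}:=\{j\in V:\mathcal{V}_j\neq\emptyset\}$ and $\mathcal{B}:=\{j\in V:\mathcal{V}_j=\emptyset\}$, both assumed non-empty. For $k\in\mathcal{V}_j$, $\Delta x_{jk}>0$ is the distance between $x_j$ and $x_k$. Time is discretized uniformly: $N\ge1$, $\Delta t=T/N$ with $T>0$, $t_n=n\Delta t$. The space-time index set is $I_T:=(\mathcal{J}\times\{0\})\cup(V\times\{1,\dots,N\})$, and grid functions are $u=\{u_j^n\}_{(j,n)\in I_T}$. For $j\in\mathcal{J}$, $n\ge1$, $\nabla_G u_j^n:=\{(u_j^n-u_k^n)/\Delta x_{jk}\}_{k\in\mathcal{V}_j}\in\mathbb{R}^{|\mathcal{V}_j|}$. For each $j\in\mathcal{J}$ a numerical Hamiltonian $\mathcal{H}(x_j,\cdot,\cdot):\mathbb{R}\times\mathbb{R}^{|\mathcal{V}_j|}\to\mathbb{R}$ is given, as are initial data $g_j^0$ ($j\in\mathcal{J}$) and boundary data $g_j^n$ ($j\in\mathcal{B}$, $1\le n\le N$). $\|\cdot\|_2$ is the Euclidean norm. Hypotheses. (H1) There are constants $[\mathcal{H}]_u,[\mathcal{H}]_p>0$, independent of $x_j$, such that $|\mathcal{H}(x_j,u,p)-\mathcal{H}(x_j,v,p)|\le[\mathcal{H}]_u|u-v|$ and $|\mathcal{H}(x_j,u,p)-\mathcal{H}(x_j,u,q)|\le[\mathcal{H}]_p\|p-q\|_\infty$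 for all $j\in\mathcal{J}$, $u,v\in\mathbb{R}$, $p,q\in\mathbb{R}^{|\mathcal{V}_j|}$. (H2) For all $j\in\mathcal{J}$, $u,v\in\mathbb{R}$, $p,q\in\mathbb{R}^{|\mathcal{V}_j|}$: $p\le q$ componentwise implies $\mathcal{H}(x_j,u,p)\le\mathcal{H}(x_j,u,q)$; and $u\le v$ implies $\mathcal{H}(x_j,u,p)\le\mathcal{H}(x_j,v,p)$. Generalized differential: $\partial L(u)$ is the convex hull of all limits of $\nabla L(u_n)$ over sequences $(u_n)$ of differentiability points of $L$ converging to $u$. *)

theory Defs
  imports "HOL-Analysis.Analysis"
begin

definition inner_nodes :: "'v set \<Rightarrow> ('v \<Rightarrow> 'v set) \<Rightarrow> 'v set" where
  "inner_nodes V nbr = {j \<in> V. nbr j \<noteq> {}}"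

definition boundary_nodes :: "'v set \<Rightarrow> ('v \<Rightarrow> 'v set) \<Rightarrow> 'v set" where
  "boundary_nodes V nbr = {j \<in> V. nbr j = {}}"

definition space_time_index :: "'v set \<Rightarrow> ('v \<Rightarrow> 'v set) \<Rightarrow> nat \<Rightarrow> ('v \<times> nat) set" where
  "space_time_index V nbr N = inner_nodes V nbr \<times> {0} \<union> V \<times> {1..N}"

text \<open>A vector indexed by the neighbours of j is an element of
  \<^term>\<open>extensional (nbr j)\<close>, i.e. a function with a fixed dummy value outside \<^term>\<open>nbr j\<close>.\<close>

definition graph_gradient ::
    "('v \<Rightarrow> 'v set) \<Rightarrow> ('v \<Rightarrow> 'v \<Rightarrow> real) \<Rightarrow> ('v \<Rightarrow> real) \<Rightarrow> 'v \<Rightarrow> ('v \<Rightarrow> real)" where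
  "graph_gradient nbr dx w j = (\<lambda>k \<in> nbr j. (w j - w k) / dx j k)"

text \<open>The value of the residual at the index (j, n), for grid values u j n. It is only
  meant for indices in \<^term>\<open>space_time_index V nbr N\<close>; there n = 0 forces j to be an inner
  node, and no value of u outside the index set is accessed.\<close>

definition residual_at ::
    "('v \<Rightarrow> 'v set) \<Rightarrow> ('v \<Rightarrow> 'v \<Rightarrow> real) \<Rightarrow> real \<Rightarrow> ('v \<Rightarrow> real \<Rightarrow> ('v \<Rightarrow> real) \<Rightarrow> real) \<Rightarrow>
     real \<Rightarrow> real \<Rightarrow> ('v \<Rightarrow> nat \<Rightarrow> real) \<Rightarrow> ('v \<Rightarrow> nat \<Rightarrow> real) \<Rightarrow> 'v \<Rightarrow> nat \<Rightarrow> real" where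
  "residual_at nbr dx dt H lam_b lam_0 g u j n =
     (if n = 0 then lam_0 * (u j 0 - g j 0)
      else if nbr j = {} then lam_b * (u j n - g j n)
      else (u j n - u j (n - 1)) / dt + H j (u j n) (graph_gradient nbr dx (\<lambda>k. u k n) j))"

text \<open>The Euclidean space of grid functions is \<^typ>\<open>real ^ 'i\<close>, where a bijection
  \<iota> from the set of space-time indices onto the finite type 'i names the coordinates:
  the value of u at node j and time level n is the component of u at \<iota> (j, n).\<close>

definition residual ::
    "('v \<times> nat \<Rightarrow> 'i::finite) \<Rightarrow> 'v set \<Rightarrow> ('v \<Rightarrow> 'v set) \<Rightarrow> ('v \<Rightarrow> 'v \<Rightarrow> real) \<Rightarrow> real \<Rightarrow> nat \<Rightarrow>
     ('v \<Rightarrow> real \<Rightarrow> ('v \<Rightarrow> real) \<Rightarrow> real) \<Rightarrow> real \<Rightarrow> real \<Rightarrow> ('v \<Rightarrow> nat \<Rightarrow> real) \<Rightarrow>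
     real ^ 'i \<Rightarrow> real ^ 'i" where
  "residual \<iota> V nbr dx T N H lam_b lam_0 g u =
     (\<chi> i. case inv_into (space_time_index V nbr N) \<iota> i of (j, n) \<Rightarrow>
        residual_at nbr dx (T / real N) H lam_b lam_0 g (\<lambda>k m. u $ \<iota> (k, m)) j n)"

definition generalized_differential :: "('a::euclidean_space \<Rightarrow> real) \<Rightarrow> 'a \<Rightarrow> 'a set" where
  "generalized_differential L u =
     convex hull {d. \<exists>X D. X \<longlonglongrightarrow> u \<and> (\<forall>m::nat. GDERIV L (X m) :> D m) \<and> D \<longlonglongrightarrow> d}"

end

theory Submission imports Defs begin

text \<open>
  Monotonicity of the Hamiltonian and the backward difference in time make the residual R
  behave like a strictly diagonally dominant matrix once the component at time level n is
  weighted by n + 1: if the increment Y - X satisfies |Y - X| \<le> m w componentwise, with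
  equality and positive sign at the index i, then R $ i increases from X to Y by at least c m
  (lemma \<open>residual_weighted_dominant\<close>). Indeed, at such an index the discrete gradient and the
  value of u both increase weakly, so the Hamiltonian does not decrease, and the growth of the
  weights in time makes the increment of the time difference quotient at least m divided by
  the time step. The Lipschitz hypothesis on the Hamiltonian makes R Lipschitz continuous.
  Everything else uses only these two properties of R.

  The decisive point is that a single direction, v = w sgn(r) with r = R u, is an ascent
  direction of L = |R|^2 at every point close to u, unless r = 0. The sign of each component of R (X + t v) - R X
  is that of r wherever r does not vanish, and its size is at least c t. Hence the inner product
  with r is at least c t times the l1 norm of r. Replacing r by R X and R (X + t v) costs
  an error of order t |X - u| + t^2, by Lipschitz continuity. So every gradient D of L at a
  point X satisfies v \<bullet> D \<ge> 2 c |r|_1 - O(|X - u|), an inequality that survives limits and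
  convex hulls. This bounds v \<bullet> d below by 2 c |r|_1 on the generalized differential at u, so 0
  can only belong to it if r = 0. Arguing with increments of R avoids a chain rule, which would
  be delicate because L may be differentiable where R is not.

  Conversely, L is quadratically small near a zero of R, so it is differentiable there with
  gradient 0. Dominance also gives the expansion estimate c |Y - X| \<le> W |R Y - R X| with W the sum
  of the weights. It makes R injective and L coercive, so L has a minimizer, and
  the minimizer is a zero of R because otherwise - v would be a descent direction.
\<close>

section \<open>Weighted dominant maps and ascent directions\<close>

text \<open>For a linear map given by a Z-matrix A (nonpositive off-diagonal entries) and positive
  weights w, this says that A w \<ge> c componentwise, so that A is a nonsingular M-matrix. Decreasing
  components are covered by exchanging X and Y.\<close>

definition weighted_dominant :: "('i \<Rightarrow> real) \<Rightarrow> real \<Rightarrow> (real ^ 'i \<Rightarrow> real ^ 'i) \<Rightarrow> bool" where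
  "weighted_dominant w c R \<longleftrightarrow>
     (\<forall>X Y i m. (\<forall>l. \<bar>Y $ l - X $ l\<bar> \<le> m * w l) \<and> Y $ i - X $ i = m * w i
        \<longrightarrow> c * m \<le> R Y $ i - R X $ i)"

lemma weighted_dominantD:
  assumes "weighted_dominant w c R"
    and "\<And>l. \<bar>Y $ l - X $ l\<bar> \<le> m * w l" and "Y $ i - X $ i = m * w i"
  shows "c * m \<le> R Y $ i - R X $ i"
  using assms unfolding weighted_dominant_def by blast

definition sgn_direction :: "('i \<Rightarrow> real) \<Rightarrow> real ^ 'i \<Rightarrow> real ^ 'i" where
  "sgn_direction w r = (\<chi> i. sgn (r $ i) * w i)"

text \<open>Where r is positive (negative), the increment t w sgn(r) has the largest
  (smallest) value allowed by the weighted bound t w, so dominance applies at that index, from X to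
  the shifted point or back. Where r vanishes, nothing is known about R, but the index does not contribute to the
  inner product.\<close>

lemma weighted_dominant_sgn_direction:
  fixes R :: "real ^ 'i::finite \<Rightarrow> real ^ 'i"
  assumes dom: "weighted_dominant w c R" and w: "\<And>i. 0 < w i" and t: "0 \<le> t"
  shows "t * (c * (\<Sum>i\<in>UNIV. \<bar>r $ i\<bar>)) \<le> inner r (R (X + t *\<^sub>R sgn_direction w r) - R X)"
proof -
  define Y where "Y = X + t *\<^sub>R sgn_direction w r"
  have le: "\<bar>Y $ l - X $ l\<bar> \<le> t * w l" for l
    using w[of l] t by (auto simp: Y_def sgn_direction_def abs_mult sgn_if)
  then have le': "\<bar>X $ l - Y $ l\<bar> \<le> t * w l" for l
    by (simp add: abs_minus_commute)
  have "t * c * \<bar>r $ i\<bar> \<le> r $ i * (R Y $ i - R X $ i)" for i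
  proof -
    consider "r $ i > 0" | "r $ i = 0" | "r $ i < 0" by linarith
    then show ?thesis
    proof cases
      case 1
      then have "Y $ i - X $ i = t * w i" by (simp add: Y_def sgn_direction_def)
      from weighted_dominantD[OF dom le this] have "c * t \<le> R Y $ i - R X $ i" .
      from mult_left_mono[OF this, of "r $ i"] 1 show ?thesis by (simp add: ac_simps)
    next
      case 2 then show ?thesis by simp
    next
      case 3
      then have "X $ i - Y $ i = t * w i" by (simp add: Y_def sgn_direction_def)
      from weighted_dominantD[OF dom le' this] have "c * t \<le> R X $ i - R Y $ i" .
      from mult_left_mono[OF this, of "- r $ i"] 3 show ?thesis by (simp add: algebra_simps)
    qed
  qed
  then have "(\<Sum>i\<in>UNIV. t * c * \<bar>r $ i\<bar>) \<le> (\<Sum>i\<in>UNIV. r $ i * (R Y $ i - R X $ i))"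
    by (intro sum_mono)
  then show ?thesis
    by (simp add: Y_def inner_vec_def sum_distrib_left mult.assoc)
qed

text \<open>The direction is chosen at u, whereas the increment starts at an arbitrary X: the estimate
  serves both for gradients at points near u and, with X = u - t v, for the descent argument
  at a minimizer. The subtracted term is the price of replacing R X and R (X + t v) by R u.\<close>

lemma square_norm_increment:
  fixes R :: "real ^ 'i::finite \<Rightarrow> real ^ 'i"
    and u :: "real ^ 'i"
  assumes dom: "weighted_dominant w c R" and w: "\<And>i. 0 < w i" and t: "0 \<le> t"
    and lip: "K-lipschitz_on UNIV R"
  defines "v \<equiv> sgn_direction w (R u)"
  shows "t * (2 * c * (\<Sum>i\<in>UNIV. \<bar>R u $ i\<bar>) - K\<^sup>2 * norm v * (norm (X + t *\<^sub>R v - u) + norm (X - u)))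
           \<le> (norm (R (X + t *\<^sub>R v)))\<^sup>2 - (norm (R X))\<^sup>2"
proof -
  define Y where "Y = X + t *\<^sub>R v"
  have K: "0 \<le> K" using lip by (rule lipschitz_on_nonneg)
  have lipn: "norm (R a - R b) \<le> K * norm (a - b)" for a b
    using lipschitz_onD[OF lip, of a b] by (simp add: dist_norm)
  have main: "t * (c * (\<Sum>i\<in>UNIV. \<bar>R u $ i\<bar>)) \<le> inner (R u) (R Y - R X)"
    unfolding Y_def v_def by (rule weighted_dominant_sgn_direction[OF dom w t])
  have step: "norm (R Y - R X) \<le> K * (t * norm v)"
    using lipn[of Y X] t by (simp add: Y_def)
  have dev: "norm ((R Y - R u) + (R X - R u)) \<le> K * (norm (Y - u) + norm (X - u))"
    using norm_triangle_ineq[of "R Y - R u" "R X - R u"] lipn[of Y u] lipn[of X u]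
    by (simp add: algebra_simps)
  have "\<bar>inner ((R Y - R u) + (R X - R u)) (R Y - R X)\<bar>
      \<le> norm ((R Y - R u) + (R X - R u)) * norm (R Y - R X)"
    by (rule Cauchy_Schwarz_ineq2)
  also have "\<dots> \<le> (K * (norm (Y - u) + norm (X - u))) * (K * (t * norm v))"
    using K by (intro mult_mono dev step) auto
  finally have err: "- (t * (K\<^sup>2 * norm v * (norm (Y - u) + norm (X - u))))
      \<le> inner ((R Y - R u) + (R X - R u)) (R Y - R X)"
    by (simp add: power2_eq_square algebra_simps abs_le_iff)
  have "(norm (R Y))\<^sup>2 - (norm (R X))\<^sup>2
      = 2 * inner (R u) (R Y - R X) + inner ((R Y - R u) + (R X - R u)) (R Y - R X)"
    by (simp only: power2_norm_eq_inner inner_diff_left inner_diff_right inner_add_left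
        inner_commute[of "R u"] inner_commute[of "R X" "R Y"]) simp
  with main err show ?thesis
    by (simp add: Y_def[symmetric] algebra_simps)
qed

text \<open>Divide the preceding estimate by t and let t decrease to 0.\<close>

lemma gderiv_sgn_direction:
  fixes R :: "real ^ 'i::finite \<Rightarrow> real ^ 'i"
    and u :: "real ^ 'i"
  assumes dom: "weighted_dominant w c R" and w: "\<And>i. 0 < w i"
    and lip: "K-lipschitz_on UNIV R"
    and D: "GDERIV (\<lambda>u. (norm (R u))\<^sup>2) X :> D"
  defines "v \<equiv> sgn_direction w (R u)"
  shows "2 * c * (\<Sum>i\<in>UNIV. \<bar>R u $ i\<bar>) - 2 * K\<^sup>2 * norm v * norm (X - u) \<le> inner v D"
proof -
  define L where "L = (\<lambda>u. (norm (R u))\<^sup>2)"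
  define S where "S = (\<Sum>i\<in>UNIV. \<bar>R u $ i\<bar>)"
  have line: "((\<lambda>t. X + t *\<^sub>R v) has_derivative (\<lambda>t. t *\<^sub>R v)) (at 0)"
    by (auto intro!: derivative_eq_intros)
  have "(L has_derivative (\<lambda>h. inner h D)) (at (X + 0 *\<^sub>R v))"
    using D by (simp add: gderiv_def L_def)
  from has_derivative_compose[OF line this]
  have "((\<lambda>t. L (X + t *\<^sub>R v)) has_real_derivative inner v D) (at 0)"
    unfolding has_field_derivative_def
    by (rule has_derivative_eq_rhs) (simp add: fun_eq_iff)
  then have "((\<lambda>t. (L (X + t *\<^sub>R v) - L X) / t) \<longlongrightarrow> inner v D) (at 0)"
    by (simp add: has_field_derivative_iff)
  then have quot: "((\<lambda>t. (L (X + t *\<^sub>R v) - L X) / t) \<longlongrightarrow> inner v D) (at_right 0)"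
    by (rule filterlim_mono) (auto simp: at_le)
  have "((\<lambda>t. 2 * c * S - K\<^sup>2 * norm v * (norm (X + t *\<^sub>R v - u) + norm (X - u)))
      \<longlongrightarrow> 2 * c * S - K\<^sup>2 * norm v * (norm (X + 0 *\<^sub>R v - u) + norm (X - u))) (at_right 0)"
    by (intro tendsto_intros)
  moreover have "\<forall>\<^sub>F t in at_right 0.
      2 * c * S - K\<^sup>2 * norm v * (norm (X + t *\<^sub>R v - u) + norm (X - u))
        \<le> (L (X + t *\<^sub>R v) - L X) / t"
    using eventually_at_right_less[of "0::real"]
  proof eventually_elim
    case (elim t)
    then show ?case
      using square_norm_increment[OF dom w _ lip, of t u X]
      by (simp add: L_def S_def v_def pos_le_divide_eq mult.commute)
  qed
  ultimately have "2 * c * S - K\<^sup>2 * norm v * (norm (X + 0 *\<^sub>R v - u) + norm (X - u)) \<le> inner v D"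
    using quot by (intro tendsto_le[OF _ quot]) auto
  then show ?thesis by (simp add: S_def)
qed

text \<open>As the direction depends on u only, the gradients along a sequence tending to u are all
  bounded below against the same vector. Their limits therefore lie in one closed half-space,
  and so does the convex hull of the limits.\<close>

lemma generalized_differential_sgn_direction:
  fixes R :: "real ^ 'i::finite \<Rightarrow> real ^ 'i"
  assumes dom: "weighted_dominant w c R" and w: "\<And>i. 0 < w i"
    and lip: "K-lipschitz_on UNIV R"
    and d: "d \<in> generalized_differential (\<lambda>u. (norm (R u))\<^sup>2) u"
  shows "2 * c * (\<Sum>i\<in>UNIV. \<bar>R u $ i\<bar>) \<le> inner (sgn_direction w (R u)) d"
proof -
  define v where "v = sgn_direction w (R u)"
  define S where "S = (\<Sum>i\<in>UNIV. \<bar>R u $ i\<bar>)"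
  have "{e. \<exists>X D. X \<longlonglongrightarrow> u \<and> (\<forall>m::nat. GDERIV (\<lambda>u. (norm (R u))\<^sup>2) (X m) :> D m) \<and> D \<longlonglongrightarrow> e}
      \<subseteq> {e. inner v e \<ge> 2 * c * S}"
  proof clarify
    fix e X D
    assume X: "X \<longlonglongrightarrow> u" and D: "\<forall>m::nat. GDERIV (\<lambda>u. (norm (R u))\<^sup>2) (X m) :> D m"
      and De: "D \<longlonglongrightarrow> e"
    have le: "2 * c * S - 2 * K\<^sup>2 * norm v * norm (X m - u) \<le> inner v (D m)" for m
      unfolding S_def v_def using D by (intro gderiv_sgn_direction[OF dom w lip]) auto
    have lim1: "(\<lambda>m. 2 * c * S - 2 * K\<^sup>2 * norm v * norm (X m - u))
        \<longlonglongrightarrow> 2 * c * S - 2 * K\<^sup>2 * norm v * norm (u - u)"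
      by (intro tendsto_intros X)
    have lim2: "(\<lambda>m. inner v (D m)) \<longlonglongrightarrow> inner v e"
      by (intro tendsto_intros De)
    show "2 * c * S \<le> inner v e"
      using LIMSEQ_le[OF lim1 lim2] le by auto
  qed
  then have "generalized_differential (\<lambda>u. (norm (R u))\<^sup>2) u \<subseteq> {e. inner v e \<ge> 2 * c * S}"
    unfolding generalized_differential_def by (intro hull_minimal convex_halfspace_ge)
  with d show ?thesis by (auto simp: v_def S_def)
qed

section \<open>Zeros and critical points of weighted dominant maps\<close>

text \<open>Dominance is applied at an index where the weighted maximum norm m of Y - X is attained.
  It gives c m \<le> |R Y - R X|, and the Euclidean norm of Y - X is at most m times the sum of the
  weights.\<close>

lemma weighted_dominant_expansive:
  fixes R :: "real ^ 'i::finite \<Rightarrow> real ^ 'i"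
  assumes dom: "weighted_dominant w c R" and w: "\<And>i. 0 < w i" and c: "0 < c"
  shows "c * norm (Y - X) \<le> (\<Sum>i\<in>UNIV. w i) * norm (R Y - R X)"
proof -
  define m where "m = Max (range (\<lambda>l. \<bar>Y $ l - X $ l\<bar> / w l))"
  have "m \<in> range (\<lambda>l. \<bar>Y $ l - X $ l\<bar> / w l)"
    unfolding m_def by (intro Max_in) auto
  then obtain i where i: "m = \<bar>Y $ i - X $ i\<bar> / w i" by blast
  have "\<bar>Y $ l - X $ l\<bar> / w l \<le> m" for l
    unfolding m_def by (intro Max_ge) auto
  then have le: "\<bar>Y $ l - X $ l\<bar> \<le> m * w l" for l
    using w by (simp add: pos_divide_le_eq)
  then have le': "\<bar>X $ l - Y $ l\<bar> \<le> m * w l" for l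
    by (simp add: abs_minus_commute)
  have mi: "\<bar>Y $ i - X $ i\<bar> = m * w i" using i w[of i] by simp
  have "c * m \<le> \<bar>R Y $ i - R X $ i\<bar>"
  proof (cases "0 \<le> Y $ i - X $ i")
    case True
    with mi weighted_dominantD[OF dom le, of i] show ?thesis by simp
  next
    case False
    with mi weighted_dominantD[OF dom le', of i] show ?thesis by simp
  qed
  also have "\<dots> \<le> norm (R Y - R X)"
    using component_le_norm_cart[of "R Y - R X" i] by simp
  finally have cm: "c * m \<le> norm (R Y - R X)" .
  have "norm (Y - X) \<le> (\<Sum>l\<in>UNIV. \<bar>(Y - X) $ l\<bar>)" by (rule norm_le_l1_cart)
  also have "\<dots> \<le> (\<Sum>l\<in>UNIV. m * w l)" using le by (intro sum_mono) simp
  finally have "norm (Y - X) \<le> m * (\<Sum>l\<in>UNIV. w l)" by (simp add: sum_distrib_left)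
  with c have "c * norm (Y - X) \<le> (\<Sum>l\<in>UNIV. w l) * (c * m)"
    by (simp add: ac_simps)
  also have "\<dots> \<le> (\<Sum>l\<in>UNIV. w l) * norm (R Y - R X)"
    using w by (intro mult_left_mono cm sum_nonneg) (auto intro: less_imp_le)
  finally show ?thesis .
qed

lemma square_norm_attains_minimum:
  fixes R :: "real ^ 'i::finite \<Rightarrow> real ^ 'i"
  assumes dom: "weighted_dominant w c R" and w: "\<And>i. 0 < w i" and c: "0 < c"
    and cont: "continuous_on UNIV R"
  obtains u where "\<And>y. (norm (R u))\<^sup>2 \<le> (norm (R y))\<^sup>2"
proof -
  define W where "W = (\<Sum>i\<in>UNIV. w i)"
  have W: "0 < W" unfolding W_def using w by (intro sum_pos) auto
  \<comment> \<open>By the expansion estimate, the norm of R exceeds its value at 0 outside the ball of this radius.\<close>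
  define \<rho> where "\<rho> = 2 * W * norm (R 0) / c"
  have \<rho>: "0 \<le> \<rho>" using W c by (simp add: \<rho>_def)
  have "\<exists>u\<in>cball 0 \<rho>. \<forall>y\<in>cball 0 \<rho>. norm (R u) \<le> norm (R y)"
    using \<rho> by (intro continuous_attains_inf continuous_on_norm continuous_on_subset[OF cont]) auto
  then obtain u where u: "\<And>y. norm y \<le> \<rho> \<Longrightarrow> norm (R u) \<le> norm (R y)"
    by (meson mem_cball_0)
  have "norm (R u) \<le> norm (R y)" for y
  proof (cases "norm y \<le> \<rho>")
    case False
    then have "2 * W * norm (R 0) < c * norm y"
      using c by (simp add: \<rho>_def divide_less_eq mult.commute not_le)
    also have "\<dots> \<le> W * norm (R y - R 0)"
      using weighted_dominant_expansive[OF dom w c, of y 0] by (simp add: W_def)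
    also have "\<dots> \<le> W * (norm (R y) + norm (R 0))"
      using W by (intro mult_left_mono norm_triangle_ineq4) auto
    finally have "W * norm (R 0) < W * norm (R y)" by (simp add: algebra_simps)
    then have "norm (R 0) < norm (R y)" using W by simp
    then show ?thesis using u[of 0] \<rho> by simp
  qed (rule u)
  then show ?thesis by (intro that[of u] power_mono) auto
qed

text \<open>If R u is not 0, a short step against the sign direction decreases the norm: the gain is
  linear in the step size t, the error quadratic.\<close>

lemma minimum_square_norm_imp_zero:
  fixes R :: "real ^ 'i::finite \<Rightarrow> real ^ 'i"
  assumes dom: "weighted_dominant w c R" and w: "\<And>i. 0 < w i" and c: "0 < c"
    and lip: "K-lipschitz_on UNIV R"
    and min: "\<And>y. (norm (R u))\<^sup>2 \<le> (norm (R y))\<^sup>2"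
  shows "R u = 0"
proof (rule ccontr)
  assume "R u \<noteq> 0"
  define v where "v = sgn_direction w (R u)"
  define S where "S = (\<Sum>i\<in>UNIV. \<bar>R u $ i\<bar>)"
  define A where "A = K\<^sup>2 * (norm v)\<^sup>2"
  have A: "0 \<le> A" by (simp add: A_def)
  have "0 < norm (R u)" using \<open>R u \<noteq> 0\<close> by simp
  also have "\<dots> \<le> S" unfolding S_def by (rule norm_le_l1_cart)
  finally have S: "0 < S" .
  \<comment> \<open>The gain per unit step is at least 2 c S and the error A t, so any positive t below 2 c S / A
    works; adding 1 to A keeps the quotient meaningful for A = 0.\<close>
  define t where "t = c * S / (A + 1)"
  have t: "0 < t" using A S c by (simp add: t_def)
  have "A * t < 2 * c * S"
  proof -
    have "A * t \<le> (A + 1) * t" using t by (simp add: algebra_simps)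
    also have "\<dots> = c * S" using A by (simp add: t_def)
    also have "\<dots> < 2 * c * S" using c S by simp
    finally show ?thesis .
  qed
  then have "0 < t * (2 * c * S - A * t)" using t by simp
  also have "\<dots> \<le> (norm (R u))\<^sup>2 - (norm (R (u - t *\<^sub>R v)))\<^sup>2"
    using square_norm_increment[OF dom w _ lip, of t u "u - t *\<^sub>R v"] t
    by (simp add: v_def[symmetric] S_def[symmetric] A_def power2_eq_square mult.assoc mult.commute mult.left_commute)
  finally show False using min[of "u - t *\<^sub>R v"] by simp
qed

text \<open>By Lipschitz continuity the square of the norm is at most K^2 |y - u|^2, which is o(|y - u|).\<close>

lemma gderiv_square_norm_zero:
  fixes R :: "real ^ 'i::finite \<Rightarrow> real ^ 'i"
  assumes lip: "K-lipschitz_on UNIV R" and "R u = 0"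
  shows "GDERIV (\<lambda>u. (norm (R u))\<^sup>2) u :> 0"
proof -
  have bound: "norm ((norm (R y))\<^sup>2 / norm (y - u)) \<le> K\<^sup>2 * norm (y - u)" for y
  proof -
    have "norm (R y) \<le> K * norm (y - u)"
      using lipschitz_onD[OF lip, of y u] assms(2) by (simp add: dist_norm)
    then have "(norm (R y))\<^sup>2 \<le> (K * norm (y - u))\<^sup>2" by (intro power_mono) auto
    then show ?thesis
      by (cases "y = u") (simp_all add: divide_le_eq power2_eq_square algebra_simps)
  qed
  have "((\<lambda>y. K\<^sup>2 * norm (y - u)) \<longlongrightarrow> K\<^sup>2 * norm (u - u)) (at u)"
    by (intro tendsto_intros)
  then have lim: "((\<lambda>y. K\<^sup>2 * norm (y - u)) \<longlongrightarrow> 0) (at u)" by simp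
  have "((\<lambda>y. (norm (R y))\<^sup>2 / norm (y - u)) \<longlongrightarrow> 0) (at u)"
    by (rule Lim_null_comparison[OF _ lim]) (simp only: bound eventually_True)
  then show ?thesis
    using assms(2) by (simp add: gderiv_def has_derivative_iff_norm)
qed

lemma zero_in_generalized_differential:
  assumes "GDERIV L u :> 0"
  shows "0 \<in> generalized_differential L u"
proof -
  have "(\<lambda>_::nat. u) \<longlonglongrightarrow> u \<and> (\<forall>m::nat. GDERIV L ((\<lambda>_. u) m) :> (\<lambda>_. 0) m) \<and> (\<lambda>_::nat. 0) \<longlonglongrightarrow> (0::'a)"
    using assms by auto
  then show ?thesis
    unfolding generalized_differential_def by (intro hull_inc CollectI exI)
qed

text \<open>The least value of the squared norm is attained at a zero, which is the only one by
  expansiveness. At a critical point, the lower bound against the sign direction forces the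
  l1 norm of R u to be nonpositive.\<close>

theorem weighted_dominant_unique_zero_critical_point:
  fixes R :: "real ^ 'i::finite \<Rightarrow> real ^ 'i"
  assumes dom: "weighted_dominant w c R" and w: "\<And>i. 0 < w i" and c: "0 < c"
    and lip: "K-lipschitz_on UNIV R"
  shows "\<exists>!u. R u = 0"
    and "0 \<in> generalized_differential (\<lambda>u. (norm (R u))\<^sup>2) u \<longleftrightarrow> R u = 0"
proof -
  obtain z where "\<And>y. (norm (R z))\<^sup>2 \<le> (norm (R y))\<^sup>2"
    using square_norm_attains_minimum[OF dom w c lipschitz_on_continuous_on[OF lip]] by blast
  then have "R z = 0" by (rule minimum_square_norm_imp_zero[OF dom w c lip])
  moreover have "x = y" if "R x = 0" "R y = 0" for x y
    using weighted_dominant_expansive[OF dom w c, of x y] that c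
    by (simp add: mult_le_0_iff)
  ultimately show "\<exists>!u. R u = 0" by blast
  show "0 \<in> generalized_differential (\<lambda>u. (norm (R u))\<^sup>2) u \<longleftrightarrow> R u = 0"
  proof
    assume "0 \<in> generalized_differential (\<lambda>u. (norm (R u))\<^sup>2) u"
    from generalized_differential_sgn_direction[OF dom w lip this]
    have "(\<Sum>i\<in>UNIV. \<bar>R u $ i\<bar>) \<le> 0" using c by (simp add: mult_le_0_iff)
    with norm_le_l1_cart[of "R u"] have "norm (R u) \<le> 0" by (rule order_trans)
    then show "R u = 0" by simp
  next
    assume "R u = 0"
    then show "0 \<in> generalized_differential (\<lambda>u. (norm (R u))\<^sup>2) u"
      by (intro zero_in_generalized_differential gderiv_square_norm_zero[OF lip])
  qed
qed

section \<open>The space-time residual is Lipschitz and weighted dominant\<close>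

lemma graph_gradient_extensional: "graph_gradient nbr dx a j \<in> extensional (nbr j)"
  by (simp add: graph_gradient_def)

lemma inner_node_level_mem:
  assumes "j \<in> inner_nodes V nbr" "n \<in> {0..N}"
  shows "(j, n) \<in> space_time_index V nbr N"
  using assms by (cases "n = 0") (auto simp: space_time_index_def inner_nodes_def)

lemma residual_component:
  assumes "bij_betw \<iota> (space_time_index V nbr N) UNIV" and "(j, n) \<in> space_time_index V nbr N"
  shows "residual \<iota> V nbr dx T N H lam_b lam_0 g u $ \<iota> (j, n)
       = residual_at nbr dx (T / real N) H lam_b lam_0 g (\<lambda>k m. u $ \<iota> (k, m)) j n"
  using assms by (simp add: residual_def bij_betw_inv_into_left)

lemma lipschitz_on_cartI:
  fixes f :: "'a::metric_space \<Rightarrow> real ^ 'i::finite"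
  assumes "\<And>i. \<exists>K. K-lipschitz_on S (\<lambda>x. f x $ i)"
  shows "\<exists>K. K-lipschitz_on S f"
proof -
  obtain K where K: "\<And>i. (K i)-lipschitz_on S (\<lambda>x. f x $ i)" using assms by metis
  have "(\<Sum>i\<in>UNIV. K i)-lipschitz_on S f"
  proof (rule lipschitz_onI)
    fix x y assume xy: "x \<in> S" "y \<in> S"
    have "dist (f x) (f y) \<le> (\<Sum>i\<in>UNIV. \<bar>(f x - f y) $ i\<bar>)"
      unfolding dist_norm by (rule norm_le_l1_cart)
    also have "\<dots> \<le> (\<Sum>i\<in>UNIV. K i * dist x y)"
      using lipschitz_onD[OF K xy] by (intro sum_mono) (simp add: dist_real_def)
    finally show "dist (f x) (f y) \<le> (\<Sum>i\<in>UNIV. K i) * dist x y"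
      by (simp add: sum_distrib_right)
  next
    show "0 \<le> (\<Sum>i\<in>UNIV. K i)" by (intro sum_nonneg lipschitz_on_nonneg[OF K])
  qed
  then show ?thesis by blast
qed

lemma lipschitz_on_component: "1-lipschitz_on S (\<lambda>u::real ^ 'i::finite. u $ i)"
  by (rule lipschitz_onI) (use dist_vec_nth_le in auto)

lemma hamiltonian_lipschitz:
  fixes u :: "'a::metric_space \<Rightarrow> real" and p :: "'a \<Rightarrow> 'k \<Rightarrow> real"
  assumes A: "finite A" "A \<noteq> {}" and nn: "0 \<le> hu" "0 \<le> hp"
    and Hu: "\<And>a b p. p \<in> extensional A \<Longrightarrow> \<bar>h a p - h b p\<bar> \<le> hu * \<bar>a - b\<bar>"
    and Hp: "\<And>a p q. p \<in> extensional A \<Longrightarrow> q \<in> extensional A \<Longrightarrow>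
               \<bar>h a p - h a q\<bar> \<le> hp * (MAX k\<in>A. \<bar>p k - q k\<bar>)"
    and ext: "\<And>x. p x \<in> extensional A"
    and u: "K-lipschitz_on S u" and p: "\<And>k. k \<in> A \<Longrightarrow> (M k)-lipschitz_on S (\<lambda>x. p x k)"
  shows "(hu * K + hp * (\<Sum>k\<in>A. M k))-lipschitz_on S (\<lambda>x. h (u x) (p x))"
proof (rule lipschitz_onI)
  have M: "0 \<le> M k" if "k \<in> A" for k using p[OF that] by (rule lipschitz_on_nonneg)
  fix x y assume xy: "x \<in> S" "y \<in> S"
  have "(MAX k\<in>A. \<bar>p x k - p y k\<bar>) \<le> (\<Sum>k\<in>A. M k) * dist x y"
  proof (rule Max.boundedI)
    fix z assume "z \<in> (\<lambda>k. \<bar>p x k - p y k\<bar>) ` A"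
    then obtain k where k: "k \<in> A" "z = \<bar>p x k - p y k\<bar>" by blast
    then have "z \<le> M k * dist x y"
      using lipschitz_onD[OF p[OF k(1)] xy] by (simp add: dist_real_def)
    also have "\<dots> \<le> (\<Sum>k\<in>A. M k) * dist x y"
      using k A M by (intro mult_right_mono member_le_sum) auto
    finally show "z \<le> (\<Sum>k\<in>A. M k) * dist x y" .
  qed (use A in auto)
  then have "hp * (MAX k\<in>A. \<bar>p x k - p y k\<bar>) \<le> hp * ((\<Sum>k\<in>A. M k) * dist x y)"
    using nn by (intro mult_left_mono) auto
  moreover have "hu * \<bar>u x - u y\<bar> \<le> hu * (K * dist x y)"
    using lipschitz_onD[OF u xy] nn by (intro mult_left_mono) (auto simp: dist_real_def)
  moreover have "\<bar>h (u x) (p x) - h (u y) (p x)\<bar> \<le> hu * \<bar>u x - u y\<bar>"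
    by (rule Hu[OF ext])
  moreover have "\<bar>h (u y) (p x) - h (u y) (p y)\<bar> \<le> hp * (MAX k\<in>A. \<bar>p x k - p y k\<bar>)"
    by (rule Hp[OF ext ext])
  ultimately show "dist (h (u x) (p x)) (h (u y) (p y)) \<le> (hu * K + hp * (\<Sum>k\<in>A. M k)) * dist x y"
    by (simp add: dist_real_def algebra_simps)
next
  have "0 \<le> K" using u by (rule lipschitz_on_nonneg)
  moreover have "0 \<le> (\<Sum>k\<in>A. M k)" using p by (intro sum_nonneg lipschitz_on_nonneg) auto
  ultimately show "0 \<le> hu * K + hp * (\<Sum>k\<in>A. M k)" using nn by simp
qed

lemma residual_lipschitz:
  fixes \<iota> :: "'v \<times> nat \<Rightarrow> 'i::finite"
  assumes V: "finite V" and nbr: "\<forall>j\<in>V. nbr j \<subseteq> V \<and> j \<notin> nbr j"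
    and bij: "bij_betw \<iota> (space_time_index V nbr N) UNIV"
    and H: "H_u > 0" "H_p > 0"
    and H1_u: "\<forall>j\<in>inner_nodes V nbr. \<forall>u v. \<forall>p\<in>extensional (nbr j).
           \<bar>H j u p - H j v p\<bar> \<le> H_u * \<bar>u - v\<bar>"
    and H1_p: "\<forall>j\<in>inner_nodes V nbr. \<forall>u. \<forall>p\<in>extensional (nbr j). \<forall>q\<in>extensional (nbr j).
           \<bar>H j u p - H j u q\<bar> \<le> H_p * (MAX k\<in>nbr j. \<bar>p k - q k\<bar>)"
  shows "\<exists>K. K-lipschitz_on UNIV (residual \<iota> V nbr dx T N H lam_b lam_0 g)"
proof (rule lipschitz_on_cartI)
  fix i
  obtain j n where jn: "(j, n) \<in> space_time_index V nbr N" and i: "i = \<iota> (j, n)"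
    using bij by (metis UNIV_I bij_betw_iff_bijections surj_pair)
  note comp = lipschitz_on_component[of UNIV]
  let ?u = "\<lambda>(u::real ^ 'i) k m. u $ \<iota> (k, m)"
  have aff: "\<exists>K. K-lipschitz_on UNIV (\<lambda>u::real ^ 'i. a * (u $ l - b))" for a b l
  proof
    show "(\<bar>a\<bar> * (1 + 0))-lipschitz_on UNIV (\<lambda>u::real ^ 'i. a * (u $ l - b))"
      by (intro lipschitz_on_cmult_real lipschitz_on_diff comp lipschitz_on_constant)
  qed
  have "\<exists>K. K-lipschitz_on UNIV (\<lambda>u. residual_at nbr dx (T / real N) H lam_b lam_0 g (?u u) j n)"
  proof (cases "n = 0 \<or> nbr j = {}")
    case True
    then show ?thesis using aff by (cases "n = 0") (simp_all add: residual_at_def)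
  next
    case False
    then have j: "j \<in> V" "j \<in> inner_nodes V nbr"
      using jn by (auto simp: space_time_index_def inner_nodes_def)
    have fin: "finite (nbr j)" using V nbr j finite_subset by blast
    have grad: "(\<bar>1 / dx j k\<bar> * (1 + 1))-lipschitz_on UNIV
        (\<lambda>u::real ^ 'i. graph_gradient nbr dx (\<lambda>k. ?u u k n) j k)" if "k \<in> nbr j" for k
    proof -
      have "(\<bar>1 / dx j k\<bar> * (1 + 1))-lipschitz_on UNIV
          (\<lambda>u::real ^ 'i. (1 / dx j k) * (u $ \<iota> (j, n) - u $ \<iota> (k, n)))"
        by (intro lipschitz_on_cmult_real lipschitz_on_diff comp)
      then show ?thesis using that by (simp add: graph_gradient_def)
    qed
    have ham: "(H_u * 1 + H_p * (\<Sum>k\<in>nbr j. \<bar>1 / dx j k\<bar> * (1 + 1)))-lipschitz_on UNIV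
        (\<lambda>u::real ^ 'i. H j (?u u j n) (graph_gradient nbr dx (\<lambda>k. ?u u k n) j))"
      using False fin H H1_u H1_p j
      by (intro hamiltonian_lipschitz grad comp graph_gradient_extensional) auto
    have "(\<bar>1 / (T / real N)\<bar> * (1 + 1))-lipschitz_on UNIV
        (\<lambda>u::real ^ 'i. (1 / (T / real N)) * (u $ \<iota> (j, n) - u $ \<iota> (j, n - 1)))"
      by (intro lipschitz_on_cmult_real lipschitz_on_diff comp)
    from lipschitz_on_add[OF this ham]
    have "\<exists>K. K-lipschitz_on UNIV (\<lambda>u::real ^ 'i.
        (1 / (T / real N)) * (u $ \<iota> (j, n) - u $ \<iota> (j, n - 1))
        + H j (?u u j n) (graph_gradient nbr dx (\<lambda>k. ?u u k n) j))" by blast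
    then show ?thesis
      using False by (simp add: residual_at_def mult.commute)
  qed
  then show "\<exists>K. K-lipschitz_on UNIV (\<lambda>u. residual \<iota> V nbr dx T N H lam_b lam_0 g u $ i)"
    by (simp add: i residual_component[OF bij jn])
qed

text \<open>The weight at time level n is n + 1. It is constant in space, so that at an index where the
  bound is attained no neighbour at the same time level can have a larger increment; it grows by
  1 per time step, so that the increment at the previous time level is smaller by at least m,
  and the time difference quotient gains m divided by the time step T / N. The summand 1 keeps
  the weight positive at the initial level. The constant is the least gain over the three kinds
  of equations: evolution, boundary and initial.\<close>

lemma residual_weighted_dominant:
  fixes \<iota> :: "'v \<times> nat \<Rightarrow> 'i::finite"
  assumes nbr: "\<forall>j\<in>V. nbr j \<subseteq> V \<and> j \<notin> nbr j"
    and dx: "\<forall>j\<in>V. \<forall>k\<in>nbr j. dx j k > 0"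
    and T: "T > 0" and N: "N \<ge> 1" and lam: "lam_b > 0" "lam_0 > 0"
    and bij: "bij_betw \<iota> (space_time_index V nbr N) UNIV"
    and H2_p: "\<forall>j\<in>inner_nodes V nbr. \<forall>u. \<forall>p\<in>extensional (nbr j). \<forall>q\<in>extensional (nbr j).
           (\<forall>k\<in>nbr j. p k \<le> q k) \<longrightarrow> H j u p \<le> H j u q"
    and H2_u: "\<forall>j\<in>inner_nodes V nbr. \<forall>u v. \<forall>p\<in>extensional (nbr j).
           u \<le> v \<longrightarrow> H j u p \<le> H j v p"
  shows "weighted_dominant (\<lambda>i. real (snd (inv_into (space_time_index V nbr N) \<iota> i)) + 1)
           (min (real N / T) (min lam_b lam_0)) (residual \<iota> V nbr dx T N H lam_b lam_0 g)"
  unfolding weighted_dominant_def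
proof (intro allI impI, elim conjE)
  let ?I = "space_time_index V nbr N"
  let ?c = "min (real N / T) (min lam_b lam_0)"
  let ?R = "residual \<iota> V nbr dx T N H lam_b lam_0 g"
  fix X Y :: "real ^ 'i" and i m
  assume le: "\<forall>l. \<bar>Y $ l - X $ l\<bar> \<le> m * (real (snd (inv_into ?I \<iota> l)) + 1)"
    and eq: "Y $ i - X $ i = m * (real (snd (inv_into ?I \<iota> i)) + 1)"
  define x where "x = (\<lambda>k n. X $ \<iota> (k, n))"
  define y where "y = (\<lambda>k n. Y $ \<iota> (k, n))"
  obtain j n where jn: "(j, n) \<in> ?I" and i: "i = \<iota> (j, n)"
    using bij by (metis UNIV_I bij_betw_iff_bijections surj_pair)
  have bound: "\<bar>y k l - x k l\<bar> \<le> m * (real l + 1)" if "(k, l) \<in> ?I" for k l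
    using le[rule_format, of "\<iota> (k, l)"] bij_betw_inv_into_left[OF bij that]
    by (simp add: x_def y_def)
  have touch: "y j n - x j n = m * (real n + 1)"
    using eq bij_betw_inv_into_left[OF bij jn] by (simp add: x_def y_def i)
  have "0 \<le> m * (real n + 1)" using bound[OF jn] by linarith
  then have m: "0 \<le> m" by (simp add: zero_le_mult_iff)
  have R: "?R Z $ i = residual_at nbr dx (T / real N) H lam_b lam_0 g (\<lambda>k m. Z $ \<iota> (k, m)) j n" for Z
    unfolding i by (rule residual_component[OF bij jn])
  consider "n = 0" | "n \<noteq> 0" "nbr j = {}" | "n \<noteq> 0" "nbr j \<noteq> {}" by blast
  then have "?c * m \<le> residual_at nbr dx (T / real N) H lam_b lam_0 g y j n
      - residual_at nbr dx (T / real N) H lam_b lam_0 g x j n"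
  proof cases
    case 1
    have "?c * m \<le> lam_0 * m" using m by (intro mult_right_mono) auto
    also have "\<dots> = lam_0 * (y j n - x j n)" using touch 1 by simp
    finally show ?thesis using 1 by (simp add: residual_at_def algebra_simps)
  next
    case 2
    have "?c * m \<le> lam_b * (m * (real n + 1))"
      using m lam by (intro mult_mono) (auto simp: algebra_simps)
    also have "\<dots> = lam_b * (y j n - x j n)" using touch by simp
    finally show ?thesis using 2 by (simp add: residual_at_def algebra_simps)
  next
    case 3
    then have j: "j \<in> V" "j \<in> inner_nodes V nbr" "n \<in> {1..N}"
      using jn by (auto simp: space_time_index_def inner_nodes_def)
    let ?p = "\<lambda>z::'v \<Rightarrow> nat \<Rightarrow> real. graph_gradient nbr dx (\<lambda>k. z k n) j"
    have grad: "?p x k \<le> ?p y k" if k: "k \<in> nbr j" for k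
    proof -
      have "(k, n) \<in> ?I" using k j nbr by (auto simp: space_time_index_def)
      from bound[OF this] touch have "x j n - x k n \<le> y j n - y k n" by linarith
      moreover have "dx j k > 0" using dx j k by blast
      ultimately show ?thesis using k by (simp add: graph_gradient_def divide_right_mono)
    qed
    have le_at: "x j n \<le> y j n"
      using touch mult_nonneg_nonneg[OF m, of "real n + 1"] by simp
    have "H j (x j n) (?p x) \<le> H j (x j n) (?p y)"
      by (intro H2_p[rule_format, OF j(2)] graph_gradient_extensional grad)
    moreover have "H j (x j n) (?p y) \<le> H j (y j n) (?p y)"
      by (intro H2_u[rule_format, OF j(2)] graph_gradient_extensional le_at)
    ultimately have ham: "H j (x j n) (?p x) \<le> H j (y j n) (?p y)" by linarith
    have prev: "(j, n - 1) \<in> ?I" using j by (intro inner_node_level_mem) auto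
    have "m * (real (n - 1) + 1) = m * (real n + 1) - m"
      using j by (simp add: of_nat_diff algebra_simps)
    then have "m \<le> (y j n - x j n) - (y j (n - 1) - x j (n - 1))"
      using bound[OF prev] touch by linarith
    then have "m / (T / real N) \<le> ((y j n - x j n) - (y j (n - 1) - x j (n - 1))) / (T / real N)"
      using T N by (intro divide_right_mono) auto
    moreover have "?c * m \<le> m / (T / real N)"
      using m mult_right_mono[of ?c "real N / T" m] by (simp add: mult.commute)
    moreover have "((y j n - x j n) - (y j (n - 1) - x j (n - 1))) / (T / real N)
        = (y j n - y j (n - 1)) / (T / real N) - (x j n - x j (n - 1)) / (T / real N)"
      by (simp only: diff_divide_distrib)
    ultimately have "?c * m \<le> (y j n - y j (n - 1)) / (T / real N) - (x j n - x j (n - 1)) / (T / real N)"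
      by linarith
    with ham 3 show ?thesis by (simp add: residual_at_def)
  qed
  then show "?c * m \<le> ?R Y $ i - ?R X $ i" by (simp add: R x_def y_def)
qed

theorem theorem7:
  fixes V :: "'v set"
    and nbr :: "'v \<Rightarrow> 'v set"
    and dx :: "'v \<Rightarrow> 'v \<Rightarrow> real"
    and T :: real
    and N :: nat
    and H :: "'v \<Rightarrow> real \<Rightarrow> ('v \<Rightarrow> real) \<Rightarrow> real"
    and H_u H_p lam_b lam_0 :: real
    and g :: "'v \<Rightarrow> nat \<Rightarrow> real"
    and \<iota> :: "'v \<times> nat \<Rightarrow> 'i::finite"
  assumes "finite V"
    and "\<forall>j\<in>V. nbr j \<subseteq> V \<and> j \<notin> nbr j"
    and "inner_nodes V nbr \<noteq> {}" and "boundary_nodes V nbr \<noteq> {}"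
    and "\<forall>j\<in>V. \<forall>k\<in>nbr j. dx j k > 0"
    and "T > 0" and "N \<ge> 1"
    and "lam_b > 0" and "lam_0 > 0"
    and "bij_betw \<iota> (space_time_index V nbr N) (UNIV :: 'i set)"
    and "H_u > 0" and "H_p > 0"
    and H1_u: "\<forall>j\<in>inner_nodes V nbr. \<forall>u v. \<forall>p\<in>extensional (nbr j).
           \<bar>H j u p - H j v p\<bar> \<le> H_u * \<bar>u - v\<bar>"
    and H1_p: "\<forall>j\<in>inner_nodes V nbr. \<forall>u. \<forall>p\<in>extensional (nbr j). \<forall>q\<in>extensional (nbr j).
           \<bar>H j u p - H j u q\<bar> \<le> H_p * (MAX k\<in>nbr j. \<bar>p k - q k\<bar>)"
    and H2_p: "\<forall>j\<in>inner_nodes V nbr. \<forall>u. \<forall>p\<in>extensional (nbr j). \<forall>q\<in>extensional (nbr j).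
           (\<forall>k\<in>nbr j. p k \<le> q k) \<longrightarrow> H j u p \<le> H j u q"
    and H2_u: "\<forall>j\<in>inner_nodes V nbr. \<forall>u v. \<forall>p\<in>extensional (nbr j).
           u \<le> v \<longrightarrow> H j u p \<le> H j v p"
  shows "let R = residual \<iota> V nbr dx T N H lam_b lam_0 g;
             L = (\<lambda>u. (norm (R u))\<^sup>2)
         in (\<exists>!u_bar. R u_bar = 0) \<and>
            (\<forall>u_bar. R u_bar = 0 \<longrightarrow>
               0 \<in> generalized_differential L u_bar \<and>
               (\<forall>u. 0 \<in> generalized_differential L u \<longrightarrow> u = u_bar))"
proof -
  define R where "R = residual \<iota> V nbr dx T N H lam_b lam_0 g"
  define w where "w = (\<lambda>i. real (snd (inv_into (space_time_index V nbr N) \<iota> i)) + 1)"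
  define c where "c = min (real N / T) (min lam_b lam_0)"
  obtain K where lip: "K-lipschitz_on UNIV R"
    using residual_lipschitz[OF assms(1,2,10,11,12) H1_u H1_p] unfolding R_def by blast
  have dom: "weighted_dominant w c R"
    unfolding R_def w_def c_def
    by (rule residual_weighted_dominant[OF assms(2,5,6,7,8,9,10) H2_p H2_u])
  have w: "0 < w i" for i by (simp add: w_def add_nonneg_pos)
  have c: "0 < c" using assms by (simp add: c_def)
  show ?thesis
    using weighted_dominant_unique_zero_critical_point[OF dom w c lip]
    unfolding R_def Let_def by blast
qed

end
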